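(* Let $d\in\mathbb{N}$, let $\Omega\subset\mathbb{C}^d$ be a nonempty open set, and let $\mathcal{X}\subset\operatorname{Hol}(\Omega)$ be a Hausdorff topological vector space satisfying properties P1, P2, P3 (see context). Let $\mathcal{F}\subset\mathcal{P}_d$ be a family of polynomials such that $V(\mathfrak{I}_{\mathcal{F}})$ is finite, where $\mathfrak{I}_{\mathcal{F}}$ is the ideal of $\mathcal{P}_d$ defined by $I(\mathcal{F})=\mathfrak{g}(\mathcal{F})\,\mathfrak{I}_{\mathcal{F}}$. Then $\mathcal{F}$ is jointly cyclic if and only if $V(\mathcal{F})\cap\Omega_{max}=\emptyset$ and $\mathfrak{g}(\mathcal{F})$ is cyclic.
   Context: All vector spaces are over $\mathbb{C}$; topological vector spaces are not assumed locally convex. $\operatorname{Hol}(\Omega)$ is the space of holomorphic functions on $\Omega$. $\mathcal{P}_d$ is the ring of polynomials in $d$ complex variables over $\mathbb{C}$, whose elements are also viewed (by restriction) as functions on $\Omega$. The properties are: P1: $\mathcal{P}_d\subset\mathcal{X}$ and $\mathcal{P}_d$ is dense in $\mathcal{X}$. P2: for each $w\in\Omega$ the evaluation functional $\Lambda_w(F)=F(w)$, $F\in\mathcal{X}$, is continuous. P3: for each $1\le j\le d$ the shift operator $S_jF(z)=z_jF(z)$ maps $\mathcal{X}$ to $\mathcal{X}$ and is continuous. For $F\in\mathcal{X}$, $S[F]:=\overline{\{PF:P\in\mathcal{P}_d\}}$ (closure in $\mathcal{X}$); $F$ is cyclic if $S[F]=\mathcal{X}$. For a family $\mathcal{F}\subset\mathcal{X}$,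 $S[\mathcal{F}]$ is the closed linear span in $\mathcal{X}$ of $\bigcup_{F\in\mathcal{F}}S[F]$; $\mathcal{F}$ is jointly cyclic if $S[\mathcal{F}]=\mathcal{X}$. For $\mathcal{F}\subset\mathcal{P}_d$: $V(\mathcal{F}):=\{w\in\mathbb{C}^d:P(w)=0\text{ for all }P\in\mathcal{F}\}$; $I(\mathcal{F})$ is the ideal of $\mathcal{P}_d$ generated by $\mathcal{F}$; $\mathfrak{g}(\mathcal{F})$ is the greatest common divisor of $\mathcal{F}$ in the unique factorization domain $\mathcal{P}_d$ (defined up to a nonzero constant); and $\mathfrak{I}_{\mathcal{F}}$ is the ideal of $\mathcal{P}_d$ with $I(\mathcal{F})=\mathfrak{g}(\mathcal{F})\,\mathfrak{I}_{\mathcal{F}}$, i.e. $\mathfrak{I}_{\mathcal{F}}=\{Q\in\mathcal{P}_d: \mathfrak{g}(\mathcal{F})Q\in I(\mathcal{F})\}$ (for a family with no nonzero element, $\mathfrak{g}(\mathcal{F})=0$ and $\mathfrak{I}_{\mathcal{F}}=\mathcal{P}_d$). Maximal domain: $\Omega_{max}$ is the set of all $w\in\mathbb{C}^d$ such that the functional $P\mapsto P(w)$ on $\mathcal{P}_d$ extends to a continuous linear functional on $\mathcal{X}$. *)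

theory Defs
  imports "HOL-Analysis.Analysis" "HOL-Library.Poly_Mapping" "HOL-Library.Function_Algebras"
begin

text \<open>
  The ring of polynomials in \<open>d = CARD('n)\<close> variables is the monoid algebra of finitely
  supported maps from exponent vectors to coefficients.
\<close>

type_synonym 'n cpoly = "('n \<Rightarrow>\<^sub>0 nat) \<Rightarrow>\<^sub>0 complex"

type_synonym 'n cfun = "complex ^ 'n \<Rightarrow> complex"

definition cpoly_eval :: "'n::finite cpoly \<Rightarrow> complex ^ 'n \<Rightarrow> complex" where
  "cpoly_eval P z =
     (\<Sum>m\<in>Poly_Mapping.keys P. Poly_Mapping.lookup P m * (\<Prod>j\<in>UNIV. (z $ j) ^ Poly_Mapping.lookup m j))"

interpretation cring: module "(*) :: 'a::comm_ring_1 \<Rightarrow> 'a \<Rightarrow> 'a"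
  by (rule module.intro) (rule distrib_left distrib_right mult.assoc[symmetric] mult_1_left)+

interpretation cfun: vector_space "\<lambda>(c::complex) (f::'a \<Rightarrow> complex) z. c * f z"
  by (rule vector_space.intro) (simp_all add: fun_eq_iff distrib_left distrib_right)

text \<open>
  A commutative ring is a module over itself; its submodules are the ideals, and the span of a
  set is the ideal generated by it.
\<close>

definition ideal_gen :: "'n::finite cpoly set \<Rightarrow> 'n cpoly set" where
  "ideal_gen \<F> = cring.span \<F>"

definition zero_set :: "'n::finite cpoly set \<Rightarrow> (complex ^ 'n) set" where
  "zero_set \<F> = {w. \<forall>P\<in>\<F>. cpoly_eval P w = 0}"

text \<open>
  Greatest common divisors are unique only up to a unit, hence a relation. If the family has no
  nonzero element, its only greatest common divisor is \<open>0\<close>.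
\<close>

definition is_gcd_of :: "'n::finite cpoly \<Rightarrow> 'n cpoly set \<Rightarrow> bool" where
  "is_gcd_of g \<F> \<longleftrightarrow> (\<forall>P\<in>\<F>. g dvd P) \<and> (\<forall>h. (\<forall>P\<in>\<F>. h dvd P) \<longrightarrow> h dvd g)"

definition quotient_ideal :: "'n::finite cpoly \<Rightarrow> 'n cpoly set \<Rightarrow> 'n cpoly set" where
  "quotient_ideal g \<F> = {Q. g * Q \<in> ideal_gen \<F>}"

text \<open>
  A function on \<open>\<Omega>\<close> is encoded as the total function extending it by \<open>0\<close> outside \<open>\<Omega>\<close>, so that
  equality of functions on \<open>\<Omega>\<close> is equality and the vector space operations are pointwise.
  Holomorphy is Frechet differentiability with complex linear derivative.
\<close>

definition Hol :: "(complex ^ 'n::finite) set \<Rightarrow> 'n cfun set" where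
  "Hol \<Omega> = {f. (\<forall>z. z \<notin> \<Omega> \<longrightarrow> f z = 0) \<and>
     (\<forall>z\<in>\<Omega>. \<exists>L. (f has_derivative L) (at z) \<and> (\<forall>c v. L (c *s v) = c * L v))}"

definition poly_on :: "(complex ^ 'n::finite) set \<Rightarrow> 'n cpoly \<Rightarrow> 'n cfun" where
  "poly_on \<Omega> P = (\<lambda>z. if z \<in> \<Omega> then cpoly_eval P z else 0)"

text \<open>
  The space is its topology: the underlying set is \<^term>\<open>topspace X\<close>, and no local convexity is
  required.
\<close>

definition hausdorff_tvs_in_Hol :: "(complex ^ 'n::finite) set \<Rightarrow> 'n cfun topology \<Rightarrow> bool" where
  "hausdorff_tvs_in_Hol \<Omega> X \<longleftrightarrow>
     topspace X \<subseteq> Hol \<Omega> \<and>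
     cfun.subspace (topspace X) \<and>
     Hausdorff_space X \<and>
     continuous_map (prod_topology X X) X (\<lambda>(F, G). F + G) \<and>
     continuous_map (prod_topology euclidean X) X (\<lambda>(c, F). (\<lambda>z. c * F z))"

definition P1 :: "(complex ^ 'n::finite) set \<Rightarrow> 'n cfun topology \<Rightarrow> bool" where
  "P1 \<Omega> X \<longleftrightarrow> range (poly_on \<Omega>) \<subseteq> topspace X \<and> X closure_of range (poly_on \<Omega>) = topspace X"

definition P2 :: "(complex ^ 'n::finite) set \<Rightarrow> 'n cfun topology \<Rightarrow> bool" where
  "P2 \<Omega> X \<longleftrightarrow> (\<forall>w\<in>\<Omega>. continuous_map X euclidean (\<lambda>F. F w))"

definition P3 :: "'n::finite cfun topology \<Rightarrow> bool" where
  "P3 X \<longleftrightarrow> (\<forall>j. continuous_map X X (\<lambda>F z. z $ j * F z))"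

definition invariant_closure :: "'n::finite cfun topology \<Rightarrow> 'n cfun \<Rightarrow> 'n cfun set" where
  "invariant_closure X F = X closure_of (range (\<lambda>P z. cpoly_eval P z * F z))"

definition cyclic :: "'n::finite cfun topology \<Rightarrow> 'n cfun \<Rightarrow> bool" where
  "cyclic X F \<longleftrightarrow> invariant_closure X F = topspace X"

definition joint_invariant_closure :: "'n::finite cfun topology \<Rightarrow> 'n cfun set \<Rightarrow> 'n cfun set" where
  "joint_invariant_closure X \<F> = X closure_of cfun.span (\<Union>F\<in>\<F>. invariant_closure X F)"

definition jointly_cyclic :: "'n::finite cfun topology \<Rightarrow> 'n cfun set \<Rightarrow> bool" where
  "jointly_cyclic X \<F> \<longleftrightarrow> joint_invariant_closure X \<F> = topspace X"

definition continuous_linear_functional ::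
    "'n::finite cfun topology \<Rightarrow> ('n cfun \<Rightarrow> complex) \<Rightarrow> bool" where
  "continuous_linear_functional X \<phi> \<longleftrightarrow>
     continuous_map X euclidean \<phi> \<and>
     (\<forall>F\<in>topspace X. \<forall>G\<in>topspace X. \<phi> (F + G) = \<phi> F + \<phi> G) \<and>
     (\<forall>c. \<forall>F\<in>topspace X. \<phi> (\<lambda>z. c * F z) = c * \<phi> F)"

definition max_domain :: "(complex ^ 'n::finite) set \<Rightarrow> 'n cfun topology \<Rightarrow> (complex ^ 'n) set" where
  "max_domain \<Omega> X =
     {w. \<exists>\<phi>. continuous_linear_functional X \<phi> \<and> (\<forall>P. \<phi> (poly_on \<Omega> P) = cpoly_eval P w)}"

end

theory Submission
  imports Defs "HOL-Computational_Algebra.Fundamental_Theorem_Algebra"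
begin

text \<open>
  Call a polynomial ideal dense if its closure in \<open>X\<close> contains \<open>1\<close>, hence is all of \<open>X\<close>. Let \<open>J\<close> be
  the quotient ideal, so that \<open>I = g J\<close> for the ideal \<open>I\<close> generated by the family. If \<open>J\<close> and \<open>(g)\<close> are
  dense, then so is \<open>I\<close>, because multiplication by \<open>g\<close> is continuous.

  If \<open>J\<close> is not dense, one point \<open>w\<close> of \<open>V(J)\<close> lies in the maximal domain. Since \<open>V(J)\<close> is finite,
  \<open>J\<close> contains for each \<open>j\<close> a product of factors \<open>z\<^sub>j - c\<close>. Adjoining to a non-dense ideal that
  contains a product one suitable factor of it keeps the ideal non-dense, so after all variables are
  treated the maximal ideal of some \<open>w \<in> V(J)\<close> is non-dense. Its closure \<open>N\<close> then has
  codimension one, \<open>X = N + \<complex> 1\<close>, and the coefficient of \<open>1\<close> is a continuous functional that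
  extends evaluation at \<open>w\<close>.

  The same adjunction, without any topology, proves the Nullstellensatz. There the product of linear
  factors comes from the uncountability of \<open>\<complex>\<close>: if \<open>z\<^sub>j - c\<close> is invertible modulo \<open>J\<close> for
  uncountably many \<open>c\<close>, the inverses are linearly dependent, and clearing denominators puts a nonzero
  polynomial in \<open>z\<^sub>j\<close> into \<open>J\<close>.
\<close>

text \<open>
  For a ring acting on itself, \<open>cring.scale_scale\<close> reads \<open>a * (b * x) = (a * b) * x\<close>: as a simp rule
  it loops with \<open>mult.assoc\<close>.
\<close>

declare cring.scale_scale [simp del]

section \<open>Polynomials and their evaluation\<close>

lemma poly_mapping_single_add_induct [case_names zero single add]:
  fixes p :: "'a \<Rightarrow>\<^sub>0 'b::comm_monoid_add"
  assumes zero: "Q 0"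
    and single: "\<And>a b. Q (Poly_Mapping.single a b)"
    and add: "\<And>p q. Q p \<Longrightarrow> Q q \<Longrightarrow> Q (p + q)"
  shows "Q p"
proof (induction p rule: Poly_Mapping.update_induct)
  case const
  show ?case by (rule zero)
next
  case (update f a b)
  \<comment> \<open>The key \<open>a\<close> lies outside the support of \<open>f\<close>, so
    updating there is the same as adding a \<open>single\<close>.\<close>
  have "Poly_Mapping.update a b f = Poly_Mapping.single a b + f"
    using update by (intro poly_mapping_eqI)
      (auto simp: lookup_update lookup_add lookup_single in_keys_iff when_def)
  then show ?case using add[OF single update(3)] by simp
qed

definition cpoly_const :: "complex \<Rightarrow> 'n::finite cpoly" where
  "cpoly_const c = Poly_Mapping.single 0 c"

definition cpoly_var :: "'n::finite \<Rightarrow> 'n cpoly" where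
  "cpoly_var j = Poly_Mapping.single (Poly_Mapping.single j 1) 1"

lemma cpoly_const_add: "cpoly_const (a + b) = cpoly_const a + cpoly_const b"
  by (simp add: cpoly_const_def single_add)

lemma cpoly_const_mult: "cpoly_const (a * b) = cpoly_const a * cpoly_const b"
  by (simp add: cpoly_const_def mult_single)

lemma cpoly_const_0 [simp]: "cpoly_const 0 = 0"
  by (simp add: cpoly_const_def)

lemma cpoly_const_1 [simp]: "cpoly_const 1 = 1"
  by (simp add: cpoly_const_def)

lemma cpoly_const_uminus: "cpoly_const (- a) = - cpoly_const a"
  using cpoly_const_add[of a "- a"] by (simp add: eq_neg_iff_add_eq_0 add.commute)

lemma cpoly_const_diff: "cpoly_const (a - b) = cpoly_const a - cpoly_const b"
  using cpoly_const_add[of a "- b"] by (simp add: cpoly_const_uminus)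

text \<open>The additional terms have coefficient zero. A common index set for \<open>P\<close>,
  \<open>Q\<close> and \<open>P + Q\<close> yields additivity even when terms cancel.\<close>

lemma cpoly_eval_superset:
  assumes "finite S" "Poly_Mapping.keys P \<subseteq> S"
  shows "cpoly_eval P z =
    (\<Sum>m\<in>S. Poly_Mapping.lookup P m * (\<Prod>j\<in>UNIV. (z $ j) ^ Poly_Mapping.lookup m j))"
  unfolding cpoly_eval_def
  by (rule sum.mono_neutral_left) (use assms in \<open>auto simp: in_keys_iff\<close>)

lemma cpoly_eval_0 [simp]: "cpoly_eval 0 z = 0"
  by (simp add: cpoly_eval_def)

lemma cpoly_eval_add [simp]: "cpoly_eval (P + Q) z = cpoly_eval P z + cpoly_eval Q z"
proof -
  let ?S = "Poly_Mapping.keys P \<union> Poly_Mapping.keys Q"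
  have "finite ?S" "Poly_Mapping.keys (P + Q) \<subseteq> ?S"
    by (auto simp: Poly_Mapping.keys_add)
  then show ?thesis
    by (simp add: cpoly_eval_superset[where S = ?S] lookup_add distrib_right sum.distrib)
qed

lemma cpoly_eval_single:
  "cpoly_eval (Poly_Mapping.single m c) z = c * (\<Prod>j\<in>UNIV. (z $ j) ^ Poly_Mapping.lookup m j)"
  by (subst cpoly_eval_superset[where S = "{m}"]) auto

lemma cpoly_eval_mult [simp]: "cpoly_eval (P * Q) z = cpoly_eval P z * cpoly_eval Q z"
proof (induction P rule: poly_mapping_single_add_induct)
  case (single m c)
  show ?case
    by (induction Q rule: poly_mapping_single_add_induct)
      (simp_all add: mult_single cpoly_eval_single lookup_add power_add prod.distrib distrib_left)
qed (simp_all add: distrib_right)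

lemma cpoly_eval_const [simp]: "cpoly_eval (cpoly_const c) z = c"
  by (simp add: cpoly_const_def cpoly_eval_single)

lemma cpoly_eval_1 [simp]: "cpoly_eval 1 z = 1"
  using cpoly_eval_const[of 1 z] by simp

lemma cpoly_eval_uminus [simp]: "cpoly_eval (- P) z = - cpoly_eval P z"
  using cpoly_eval_add[of P "- P" z] by (simp add: eq_neg_iff_add_eq_0 add.commute)

lemma cpoly_eval_diff [simp]: "cpoly_eval (P - Q) z = cpoly_eval P z - cpoly_eval Q z"
  using cpoly_eval_add[of P "- Q" z] by simp

lemma cpoly_eval_var [simp]: "cpoly_eval (cpoly_var j) z = z $ j"
proof -
  have "(\<Prod>i\<in>UNIV. (z $ i) ^ Poly_Mapping.lookup (Poly_Mapping.single j 1) i)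
      = (\<Prod>i\<in>UNIV. if i = j then z $ i else 1)"
    by (intro prod.cong) (auto simp: lookup_single when_def)
  then show ?thesis
    by (simp add: cpoly_var_def cpoly_eval_single)
qed

text \<open>Constants and variables generate the polynomial ring. In this form, continuity of
  multiplication by a polynomial reduces to scalar multiplication and the shifts.\<close>

lemma cpoly_induct [case_names const var add mult]:
  fixes P :: "'n::finite cpoly"
  assumes const: "\<And>c. Q (cpoly_const c)"
    and var: "\<And>j. Q (cpoly_var j)"
    and add: "\<And>P R. Q P \<Longrightarrow> Q R \<Longrightarrow> Q (P + R)"
    and mult: "\<And>P R. Q P \<Longrightarrow> Q R \<Longrightarrow> Q (P * R)"
  shows "Q P"
proof (induction P rule: poly_mapping_single_add_induct)
  case zero
  show ?case using const[of 0] by simp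
next
  case (single m c)
  have "Q (Poly_Mapping.single m 1)"
  proof (induction m rule: poly_mapping_single_add_induct)
    case zero
    show ?case using const[of 1] by simp
  next
    case (single j k)
    show ?case
    proof (induction k)
      case 0
      show ?case using const[of 1] by simp
    next
      case (Suc k)
      have "Poly_Mapping.single (Poly_Mapping.single j (Suc k)) 1
          = cpoly_var j * Poly_Mapping.single (Poly_Mapping.single j k) (1::complex)"
        by (simp add: cpoly_var_def mult_single flip: single_add)
      then show ?case using mult[OF var Suc] by simp
    qed
  next
    case (add m m')
    then show ?case
      using mult[OF add] by (simp add: mult_single)
  qed
  from mult[OF const[of c] this] show ?case
    by (simp add: cpoly_const_def mult_single)
qed (rule add)

subsection \<open>Closure operators on ideals\<close>

text \<open>Common ground of the identity and the topological closure: \<open>least\<close> combines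
  monotonicity with idempotence, and \<open>mult\<close> stands for continuity of multiplication by
  \<open>a\<close>.\<close>

locale ideal_closure =
  fixes C :: "'a::comm_ring_1 set \<Rightarrow> 'a set"
  assumes extensive: "K \<subseteq> C K"
    and least: "K \<subseteq> C K' \<Longrightarrow> C K \<subseteq> C K'"
    and ideal: "cring.subspace K \<Longrightarrow> cring.subspace (C K)"
    and mult: "p \<in> C K \<Longrightarrow> a * p \<in> C ((*) a ` K)"
begin

lemma mono: "K \<subseteq> K' \<Longrightarrow> C K \<subseteq> C K'"
  using extensive least by blast

text \<open>If \<open>1\<close> is in the closure of (p) + K, multiplication by \<open>a\<close>
  puts \<open>a\<close> into the closure of (a p) + K. That closure is an ideal containing
  \<open>a\<close> and \<open>K\<close>, hence it contains \<open>1\<close> by the hypothesis on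
  \<open>a\<close>.\<close>

lemma one_in_closure_prod_list:
  assumes K: "cring.subspace K"
    and "\<And>a. a \<in> set as \<Longrightarrow> 1 \<in> C (cring.span (insert a K))"
  shows "1 \<in> C (cring.span (insert (prod_list as) K))"
  using assms(2)
proof (induction as)
  case Nil
  show ?case
    using extensive cring.span_base[of 1 "insert 1 K"] by auto
next
  case (Cons a as)
  let ?p = "prod_list as" and ?K' = "cring.span (insert (a * prod_list as) K)"
  have "a * 1 \<in> C ((*) a ` cring.span (insert ?p K))"
    using Cons by (intro mult) auto
  also have "(*) a ` cring.span (insert ?p K) \<subseteq> ?K'"
  proof (intro image_subsetI)
    fix x assume "x \<in> cring.span (insert ?p K)"
    then obtain k where "x - k * ?p \<in> cring.span K"
      by (auto simp: cring.span_insert)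
    then have "a * (x - k * ?p) \<in> cring.span K"
      by (rule cring.span_scale)
    moreover have "a * (x - k * ?p) = a * x - k * (a * ?p)"
      by (simp add: right_diff_distrib mult.left_commute)
    ultimately show "a * x \<in> ?K'"
      unfolding cring.span_insert by auto
  qed
  then have "C ((*) a ` cring.span (insert ?p K)) \<subseteq> C ?K'"
    by (rule mono)
  finally have "a \<in> C ?K'" by simp
  moreover have "K \<subseteq> C ?K'"
    using order_trans[OF cring.span_superset[of "insert (a * prod_list as) K"] extensive] by simp
  ultimately have "cring.span (insert a K) \<subseteq> C ?K'"
    by (intro cring.span_minimal ideal cring.subspace_span) auto
  then have "C (cring.span (insert a K)) \<subseteq> C ?K'"
    by (rule least)
  then show ?case using Cons.prems[of a] by auto
qed

text \<open>Adjoining a product that already lies in \<open>K\<close> does not enlarge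
  \<open>K\<close>, so not every factor can make the closure contain \<open>1\<close>.\<close>

lemma ex_factor_not_dense:
  assumes "cring.subspace K" "1 \<notin> C K" "prod_list as \<in> K"
  shows "\<exists>a\<in>set as. 1 \<notin> C (cring.span (insert a K))"
proof (rule ccontr)
  assume "\<not> ?thesis"
  then have "1 \<in> C (cring.span (insert (prod_list as) K))"
    using one_in_closure_prod_list assms(1) by blast
  also have "cring.span (insert (prod_list as) K) = K"
    using assms by (simp add: insert_absorb)
  finally show False using assms by simp
qed

end

text \<open>Modulo \<open>K\<close> every variable is a constant, hence so is every polynomial. For
  products, PR - P(w)R(w) = R(P - P(w)) + P(w)(R - R(w)).\<close>

lemma cpoly_diff_eval_in_ideal:
  assumes K: "cring.subspace K" and "\<And>j. cpoly_var j - cpoly_const (w $ j) \<in> K"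
  shows "P - cpoly_const (cpoly_eval P w) \<in> K"
proof (induction P rule: cpoly_induct)
  case (const c)
  show ?case using K by (simp add: cring.subspace_0)
next
  case (var j)
  show ?case using assms(2) by simp
next
  case (add P R)
  from cring.subspace_add[OF K add] show ?case
    by (simp add: cpoly_const_add algebra_simps)
next
  case (mult P R)
  have "R * (P - cpoly_const (cpoly_eval P w)) + cpoly_const (cpoly_eval P w) * (R - cpoly_const (cpoly_eval R w)) \<in> K"
    using mult by (intro cring.subspace_add[OF K] cring.subspace_scale[OF K])
  then show ?case
    by (simp add: cpoly_const_mult algebra_simps)
qed

text \<open>The variables are treated one after another; \<open>step\<close> is demanded for all
  ideals above \<open>J\<close> because the ideal grows on the way. The last ideal contains every
  z_j - w_j, hence the maximal ideal of \<open>w\<close>.\<close>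

lemma ex_zero_not_dense:
  fixes J :: "'n::finite cpoly set"
  assumes C: "ideal_closure C" and J: "cring.subspace J" "1 \<notin> C J"
    and step: "\<And>K j. cring.subspace K \<Longrightarrow> J \<subseteq> K \<Longrightarrow> 1 \<notin> C K \<Longrightarrow>
      \<exists>c. 1 \<notin> C (cring.span (insert (cpoly_var j - cpoly_const c) K))"
  shows "\<exists>w\<in>zero_set J. 1 \<notin> C {P. cpoly_eval P w = 0}"
proof -
  interpret ideal_closure C by (rule C)
  have "\<exists>w. 1 \<notin> C (cring.span (J \<union> (\<lambda>j. cpoly_var j - cpoly_const (w j)) ` V))" if "finite V" for V
    using that
  proof (induction V rule: finite_induct)
    case empty
    have "cring.span J = J" using J by simp
    then have "1 \<notin> C (cring.span J)" using J by (simp only: not_False_eq_True)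
    then show ?case by simp
  next
    case (insert i V)
    then obtain w where w: "1 \<notin> C (cring.span (J \<union> (\<lambda>j. cpoly_var j - cpoly_const (w j)) ` V))"
      by blast
    let ?K = "cring.span (J \<union> (\<lambda>j. cpoly_var j - cpoly_const (w j)) ` V)"
    obtain c where c: "1 \<notin> C (cring.span (insert (cpoly_var i - cpoly_const c) ?K))"
      using step[OF cring.subspace_span _ w, of i] cring.span_superset by blast
    \<comment> \<open>Since \<open>i\<close> is not in \<open>V\<close>, the update keeps the
      coordinates chosen earlier.\<close>
    let ?w = "w(i := c)"
    have "cring.span (J \<union> (\<lambda>j. cpoly_var j - cpoly_const (?w j)) ` insert i V)
        \<subseteq> cring.span (insert (cpoly_var i - cpoly_const c) ?K)"
    proof (intro cring.span_minimal cring.subspace_span)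
      have "J \<union> (\<lambda>j. cpoly_var j - cpoly_const (w j)) ` V \<subseteq> ?K"
        by (rule cring.span_superset)
      moreover have "insert (cpoly_var i - cpoly_const c) ?K
          \<subseteq> cring.span (insert (cpoly_var i - cpoly_const c) ?K)"
        by (rule cring.span_superset)
      moreover have "(\<lambda>j. cpoly_var j - cpoly_const (?w j)) ` V
          = (\<lambda>j. cpoly_var j - cpoly_const (w j)) ` V"
        using insert.hyps by (intro image_cong) auto
      ultimately show "J \<union> (\<lambda>j. cpoly_var j - cpoly_const (?w j)) ` insert i V
          \<subseteq> cring.span (insert (cpoly_var i - cpoly_const c) ?K)"
        by auto
    qed
    then show ?case using mono c by blast
  qed
  from this[OF finite] obtain u where
    u: "1 \<notin> C (cring.span (J \<union> range (\<lambda>j. cpoly_var j - cpoly_const (u j))))"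
    by blast
  define w where "w = (\<chi> j. u j)"
  define K where "K = cring.span (J \<union> range (\<lambda>j. cpoly_var j - cpoly_const (w $ j)))"
  have K: "cring.subspace K" "J \<subseteq> K" "\<And>j. cpoly_var j - cpoly_const (w $ j) \<in> K" "1 \<notin> C K"
    using u cring.span_superset[of "J \<union> range (\<lambda>j. cpoly_var j - cpoly_const (w $ j))"]
    by (auto simp: K_def w_def)
  have *: "P - cpoly_const (cpoly_eval P w) \<in> K" for P
    by (rule cpoly_diff_eval_in_ideal) (use K in auto)
  have "1 \<notin> K" using K(4) extensive by blast
  have "cpoly_eval P w = 0" if "P \<in> J" for P
  proof (rule ccontr)
    assume nz: "cpoly_eval P w \<noteq> 0"
    \<comment> \<open>The difference is the constant P(w), a unit, which would force
      \<open>1\<close> into \<open>K\<close>.\<close>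
    have "P - (P - cpoly_const (cpoly_eval P w)) \<in> K"
      using that K(2) by (intro cring.subspace_diff K *) auto
    then have "cpoly_const (inverse (cpoly_eval P w)) * cpoly_const (cpoly_eval P w) \<in> K"
      using cring.subspace_scale[OF K(1)] by simp
    then show False
      using \<open>1 \<notin> K\<close> nz by (simp flip: cpoly_const_mult)
  qed
  then have "w \<in> zero_set J" by (simp add: zero_set_def)
  moreover have "{P. cpoly_eval P w = 0} \<subseteq> K"
    using * by (auto, metis cpoly_const_0 diff_zero)
  then have "1 \<notin> C {P. cpoly_eval P w = 0}"
    using K(4) mono by blast
  ultimately show ?thesis by blast
qed

lemma ideal_closure_id: "ideal_closure (\<lambda>K. K)"
  by unfold_locales auto

subsection \<open>Ideals with finitely many zeros\<close>

text \<open>The value of a univariate polynomial at \<open>x\<close>, its coefficients embedded as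
  constants. The lemmas below make this a ring homomorphism in \<open>p\<close>, so factorizations
  over \<complex> carry over.\<close>

definition cpoly_subst :: "complex poly \<Rightarrow> 'n::finite cpoly \<Rightarrow> 'n cpoly" where
  "cpoly_subst p x = poly (map_poly cpoly_const p) x"

lemma cpoly_subst_0 [simp]: "cpoly_subst 0 x = 0"
  by (simp add: cpoly_subst_def)

lemma cpoly_subst_pCons [simp]: "cpoly_subst (pCons a p) x = cpoly_const a + x * cpoly_subst p x"
  by (simp add: cpoly_subst_def map_poly_pCons)

lemma cpoly_subst_1 [simp]: "cpoly_subst 1 x = 1"
  by (simp add: one_pCons)

lemma cpoly_subst_add [simp]: "cpoly_subst (p + q) x = cpoly_subst p x + cpoly_subst q x"
  by (induction p q rule: poly_induct2) (simp_all add: cpoly_const_add algebra_simps)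

lemma cpoly_subst_smult [simp]: "cpoly_subst (smult a p) x = cpoly_const a * cpoly_subst p x"
  by (induction p) (simp_all add: cpoly_const_mult distrib_left mult.left_commute)

lemma cpoly_subst_mult [simp]: "cpoly_subst (p * q) x = cpoly_subst p x * cpoly_subst q x"
proof (induction p)
  case (pCons a p)
  have "cpoly_subst (pCons a p * q) x = cpoly_const a * cpoly_subst q x + x * cpoly_subst (p * q) x"
    by simp
  then show ?case
    by (simp only: pCons cpoly_subst_pCons distrib_right mult.assoc)
qed simp

lemma cpoly_subst_sum: "cpoly_subst (\<Sum>i\<in>A. f i) x = (\<Sum>i\<in>A. cpoly_subst (f i) x)"
  by (induction A rule: infinite_finite_induct) simp_all

lemma cpoly_subst_prod: "cpoly_subst (\<Prod>i\<in>A. f i) x = (\<Prod>i\<in>A. cpoly_subst (f i) x)"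
  by (induction A rule: infinite_finite_induct) simp_all

text \<open>Over \<complex> the polynomial \<open>p\<close> splits into linear factors, and its
  leading coefficient is a unit that can be cancelled.\<close>

lemma ex_prod_linear_in_ideal:
  assumes J: "cring.subspace J" and "p \<noteq> 0" "cpoly_subst p x \<in> J"
  shows "\<exists>cs. (\<Prod>c\<leftarrow>cs. x - cpoly_const c) \<in> J"
proof -
  obtain cs where cs: "mset cs = proots p"
    using ex_mset by blast
  have "p = smult (lead_coeff p) (\<Prod>c\<in>#proots p. [:- c, 1:])"
    by (rule complex_poly_decompose_multiset[symmetric])
  also have "(\<Prod>c\<in>#proots p. [:- c, 1:]) = (\<Prod>c\<leftarrow>cs. [:- c, 1:])"
    by (simp add: cs[symmetric] flip: prod_mset_prod_list)
  finally have "cpoly_subst p x = cpoly_const (lead_coeff p) * cpoly_subst (\<Prod>c\<leftarrow>cs. [:- c, 1:]) x"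
    by (metis cpoly_subst_smult)
  also have "cpoly_subst (\<Prod>c\<leftarrow>cs. [:- c, 1:]) x = (\<Prod>c\<leftarrow>cs. x - cpoly_const c)"
    by (induction cs) (simp_all only: list.map prod_list.Nil prod_list.Cons cpoly_subst_mult cpoly_subst_1,
      simp add: cpoly_const_uminus)
  finally have "cpoly_const (inverse (lead_coeff p)) * (cpoly_const (lead_coeff p) * (\<Prod>c\<leftarrow>cs. x - cpoly_const c)) \<in> J"
    using cring.subspace_scale[OF J] assms(3) by metis
  then have "(\<Prod>c\<leftarrow>cs. x - cpoly_const c) \<in> J"
    using \<open>p \<noteq> 0\<close> by (simp add: mult.assoc[symmetric] flip: cpoly_const_mult)
  then show ?thesis ..
qed

section \<open>Linear dependence and products of linear factors\<close>

lemma countable_exponents: "countable (UNIV :: ('n::finite \<Rightarrow>\<^sub>0 nat) set)"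
proof (rule countableI')
  show "inj (\<lambda>m::'n \<Rightarrow>\<^sub>0 nat. to_nat (Poly_Mapping.lookup m))"
    by (auto simp: inj_def)
qed

lemma sum_fun_apply: "(\<Sum>i\<in>A. f i) x = (\<Sum>i\<in>A. f i x)"
  by (induction A rule: infinite_finite_induct) auto

text \<open>Polynomials supported in a fixed finite set thus form a space of finite dimension, here
  seen through their coefficient functions.\<close>

lemma lookup_in_span_indicators:
  assumes "finite S" "Poly_Mapping.keys P \<subseteq> S"
  shows "Poly_Mapping.lookup P \<in> cfun.span ((\<lambda>m n. if n = m then 1 else 0) ` S)"
proof -
  let ?e = "\<lambda>m n. if n = m then (1::complex) else 0"
  have "Poly_Mapping.lookup P = (\<Sum>m\<in>S. (\<lambda>n. Poly_Mapping.lookup P m * ?e m n))"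
  proof
    fix n
    have "(\<Sum>m\<in>S. (\<lambda>n. Poly_Mapping.lookup P m * ?e m n)) n
        = (\<Sum>m\<in>S. if n = m then Poly_Mapping.lookup P m else 0)"
      by (simp add: sum_fun_apply if_distrib cong: if_cong)
    also have "\<dots> = Poly_Mapping.lookup P n"
      using assms by (auto simp: in_keys_iff)
    finally show "Poly_Mapping.lookup P n = (\<Sum>m\<in>S. (\<lambda>n. Poly_Mapping.lookup P m * ?e m n)) n" ..
  qed
  also have "\<dots> \<in> cfun.span (?e ` S)"
    by (intro cfun.span_sum cfun.span_scale cfun.span_base) auto
  finally show ?thesis .
qed

text \<open>
  Only countably many supports occur, so infinitely many of the polynomials share one finite support.
\<close>

lemma uncountable_linear_dependence:
  fixes R :: "complex \<Rightarrow> 'n::finite cpoly"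
  assumes "uncountable \<Lambda>" "inj_on R \<Lambda>"
  shows "\<exists>T u. finite T \<and> T \<subseteq> \<Lambda> \<and> (\<exists>c\<in>T. u c \<noteq> 0) \<and> (\<Sum>c\<in>T. cpoly_const (u c) * R c) = 0"
proof -
  have "\<exists>S. finite S \<and> infinite {c\<in>\<Lambda>. Poly_Mapping.keys (R c) = S}"
  proof (rule ccontr)
    assume "\<not> ?thesis"
    then have "countable (\<Union>S\<in>{S. finite S}. {c\<in>\<Lambda>. Poly_Mapping.keys (R c) = S})"
      using countable_Collect_finite_subset[OF countable_exponents]
      by (intro countable_UN) (auto intro: countable_finite)
    moreover have "(\<Union>S\<in>{S. finite S}. {c\<in>\<Lambda>. Poly_Mapping.keys (R c) = S}) = \<Lambda>"
      using finite_keys by blast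
    ultimately show False using assms by simp
  qed
  then obtain S where S: "finite S" "infinite {c\<in>\<Lambda>. Poly_Mapping.keys (R c) = S}"
    by blast
  let ?L = "{c\<in>\<Lambda>. Poly_Mapping.keys (R c) = S}" and ?f = "\<lambda>c. Poly_Mapping.lookup (R c)"
  have inj: "inj_on ?f ?L"
    using assms(2) by (auto simp: inj_on_def)
  have "?f ` ?L \<subseteq> cfun.span ((\<lambda>m n. if n = m then 1 else 0) ` S)"
    using lookup_in_span_indicators S(1) by blast
  moreover have "infinite (?f ` ?L)"
    using S inj finite_imageD by blast
  \<comment> \<open>An independent set in the span of finitely many vectors is finite.\<close>
  ultimately have "cfun.dependent (?f ` ?L)"
    using cfun.independent_span_bound S(1) by blast
  then obtain t r where t: "finite t" "t \<subseteq> ?f ` ?L" "(\<Sum>v\<in>t. (\<lambda>z. r v * v z)) = 0" "\<exists>v\<in>t. r v \<noteq> 0"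
    unfolding cfun.dependent_explicit by blast
  then obtain T where T: "T \<subseteq> ?L" "t = ?f ` T"
    by (meson subset_image_iff)
  have injT: "inj_on ?f T" using inj T inj_on_subset by blast
  have "finite T" using t(1) T(2) injT finite_imageD by blast
  moreover have "(\<Sum>c\<in>T. cpoly_const (r (?f c)) * R c) = 0"
  proof (rule poly_mapping_eqI)
    fix m
    have "Poly_Mapping.lookup (cpoly_const a * P) m = a * Poly_Mapping.lookup P m" for a and P :: "'n cpoly"
      by (induction P rule: poly_mapping_single_add_induct)
        (auto simp: cpoly_const_def mult_single lookup_single when_def distrib_left lookup_add)
    then have "Poly_Mapping.lookup (\<Sum>c\<in>T. cpoly_const (r (?f c)) * R c) m = (\<Sum>c\<in>T. r (?f c) * ?f c m)"
      by (simp add: lookup_sum)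
    also have "\<dots> = (\<Sum>v\<in>t. (\<lambda>z. r v * v z)) m"
      using injT by (simp add: T(2) sum.reindex sum_fun_apply)
    finally show "Poly_Mapping.lookup (\<Sum>c\<in>T. cpoly_const (r (?f c)) * R c) m = Poly_Mapping.lookup 0 m"
      using t(3) by simp
  qed
  ultimately show ?thesis
    using T t(4) by (intro exI[of _ T] exI[of _ "r \<circ> ?f"]) auto
qed

lemma ex_prod_linear_in_ideal_of_uncountable:
  fixes J :: "'n::finite cpoly set"
  assumes J: "cring.subspace J" and "uncountable \<Lambda>"
    and unit: "\<And>c. c \<in> \<Lambda> \<Longrightarrow> 1 \<in> cring.span (insert (x - cpoly_const c) J)"
  shows "\<exists>cs. (\<Prod>c\<leftarrow>cs. x - cpoly_const c) \<in> J"
proof (cases "1 \<in> J")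
  case True
  then show ?thesis by (intro exI[of _ "[]"]) simp
next
  case False
  have "\<exists>r. 1 - r * (x - cpoly_const c) \<in> J" if "c \<in> \<Lambda>" for c
  proof -
    have span: "cring.span J = J" using J by simp
    show ?thesis using unit[OF that] unfolding cring.span_insert span by simp
  qed
  then obtain R where R: "\<And>c. c \<in> \<Lambda> \<Longrightarrow> 1 - R c * (x - cpoly_const c) \<in> J"
    by metis
  \<comment> \<open>Two points with the same inverse \<open>R a\<close> would give (a - b)
    \<open>R a\<close> in \<open>J\<close>, hence \<open>R a\<close> and then \<open>1\<close> in
    \<open>J\<close>.\<close>
  have "inj_on R \<Lambda>"
  proof (rule inj_onI, rule ccontr)
    fix a b assume ab: "a \<in> \<Lambda>" "b \<in> \<Lambda>" "R a = R b" "a \<noteq> b"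
    have "(1 - R a * (x - cpoly_const a)) - (1 - R b * (x - cpoly_const b)) \<in> J"
      using ab R by (intro cring.subspace_diff[OF J, of "1 - _" "1 - _"])
    then have "R a * cpoly_const (a - b) \<in> J"
      using ab by (simp add: cpoly_const_diff algebra_simps)
    then have "cpoly_const (inverse (a - b)) * (R a * cpoly_const (a - b)) \<in> J"
      by (rule cring.subspace_scale[OF J])
    also have "cpoly_const (inverse (a - b)) * (R a * cpoly_const (a - b))
        = R a * cpoly_const (inverse (a - b) * (a - b))"
      by (simp only: cpoly_const_mult ac_simps)
    also have "\<dots> = R a" using ab by simp
    finally have "(1 - R a * (x - cpoly_const a)) + (x - cpoly_const a) * R a \<in> J"
      using R[OF ab(1)] by (intro cring.subspace_add[OF J] cring.subspace_scale[OF J])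
    then show False using False by (simp add: mult.commute)
  qed
  with \<open>uncountable \<Lambda>\<close> obtain T u where T: "finite T" "T \<subseteq> \<Lambda>" "\<exists>c\<in>T. u c \<noteq> 0"
      and sum0: "(\<Sum>c\<in>T. cpoly_const (u c) * R c) = 0"
    using uncountable_linear_dependence[of \<Lambda> R] by auto
  \<comment> \<open>The numerator of the sum of u(c)/(t - c) over the common denominator. At a point
    \<open>a\<close> of \<open>T\<close> only the summand for \<open>a\<close> survives, so
    \<open>p\<close> is nonzero when u(a) is.\<close>
  define p where "p = (\<Sum>c\<in>T. smult (u c) (\<Prod>b\<in>T - {c}. [:- b, 1:]))"
  have "p \<noteq> 0"
  proof -
    obtain a where a: "a \<in> T" "u a \<noteq> 0" using T by blast
    have "poly p a = (\<Sum>c\<in>T. u c * (\<Prod>b\<in>T - {c}. a - b))"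
      by (simp add: p_def poly_sum poly_prod)
    also have "\<dots> = (\<Sum>c\<in>{a}. u c * (\<Prod>b\<in>T - {c}. a - b))"
      using a T by (intro sum.mono_neutral_right) auto
    also have "\<dots> \<noteq> 0" using a T by simp
    finally show ?thesis by auto
  qed
  moreover have "cpoly_subst p x \<in> J"
  proof -
    let ?q = "\<lambda>S. \<Prod>b\<in>S. x - cpoly_const b"
    have lin: "cpoly_subst [:- b, 1:] x = x - cpoly_const b" for b
      by (simp add: cpoly_const_uminus)
    have "cpoly_subst p x = (\<Sum>c\<in>T. cpoly_const (u c) * ?q (T - {c}))"
      by (simp only: p_def cpoly_subst_sum cpoly_subst_smult cpoly_subst_prod lin)
    \<comment> \<open>Subtracting the multiple \<open>?q T\<close> of the dependence relation
      changes nothing, and turns every summand into a multiple of some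
      \<open>1 - R c * (x - cpoly_const c)\<close> in \<open>J\<close>.\<close>
    also have "\<dots> = (\<Sum>c\<in>T. cpoly_const (u c) * ?q (T - {c})) - ?q T * (\<Sum>c\<in>T. cpoly_const (u c) * R c)"
      by (simp add: sum0)
    also have "\<dots> = (\<Sum>c\<in>T. cpoly_const (u c) * ?q (T - {c}) * (1 - R c * (x - cpoly_const c)))"
      unfolding sum_distrib_left sum_subtractf[symmetric]
    proof (rule sum.cong)
      fix c assume "c \<in> T"
      then have "?q T = (x - cpoly_const c) * ?q (T - {c})"
        using T(1) by (simp add: prod.remove)
      moreover have "k * q - (l * q) * (k * r) = k * q * (1 - r * l)" for k q l r :: "'n cpoly"
        by (simp add: right_diff_distrib ac_simps)
      ultimately show "cpoly_const (u c) * ?q (T - {c}) - ?q T * (cpoly_const (u c) * R c)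
          = cpoly_const (u c) * ?q (T - {c}) * (1 - R c * (x - cpoly_const c))"
        by (simp only:)
    qed simp
    also have "\<dots> \<in> J"
      using T R by (intro cring.subspace_sum[OF J] cring.subspace_scale[OF J]) auto
    finally show ?thesis .
  qed
  ultimately show ?thesis using ex_prod_linear_in_ideal[OF J] by blast
qed

section \<open>The weak Nullstellensatz and its consequence for finite zero sets\<close>

text \<open>If all z_j - c were invertible modulo \<open>K\<close>, then \<open>K\<close> would
  contain a product of such factors, and one factor of a product in a proper ideal is not invertible
  modulo it.\<close>

lemma weak_nullstellensatz:
  fixes J :: "'n::finite cpoly set"
  assumes "cring.subspace J" "1 \<notin> J"
  shows "zero_set J \<noteq> {}"
proof -
  have "\<exists>w\<in>zero_set J. 1 \<notin> {P. cpoly_eval P w = 0}"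
  proof (rule ex_zero_not_dense[OF ideal_closure_id assms])
    fix K :: "'n cpoly set" and j
    assume K: "cring.subspace K" "1 \<notin> K"
    show "\<exists>c. 1 \<notin> cring.span (insert (cpoly_var j - cpoly_const c) K)"
    proof (rule ccontr)
      assume *: "\<not> ?thesis"
      then obtain cs where "(\<Prod>c\<leftarrow>cs. cpoly_var j - cpoly_const c) \<in> K"
        using ex_prod_linear_in_ideal_of_uncountable[OF K(1) uncountable_UNIV_complex] by blast
      then have "\<exists>a\<in>set (map (\<lambda>c. cpoly_var j - cpoly_const c) cs). 1 \<notin> cring.span (insert a K)"
        by (rule ideal_closure.ex_factor_not_dense[OF ideal_closure_id K])
      with * show False by auto
    qed
  qed
  then show ?thesis by blast
qed

text \<open>Unless \<open>c\<close> is the j-th coordinate of a zero of \<open>J\<close>, the ideal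
  generated by z_j - c and \<open>J\<close> has no zero, so it contains \<open>1\<close>. Only
  finitely many \<open>c\<close> are excluded.\<close>

lemma ex_prod_linear_in_ideal_of_finite_zero_set:
  fixes J :: "'n::finite cpoly set"
  assumes J: "cring.subspace J" and "finite (zero_set J)"
  shows "\<exists>cs. (\<Prod>c\<leftarrow>cs. cpoly_var j - cpoly_const c) \<in> J"
proof (rule ex_prod_linear_in_ideal_of_uncountable[OF J])
  have "countable ((\<lambda>w. w $ j) ` zero_set J)"
    using assms by (intro countable_finite) auto
  then show "uncountable (UNIV - (\<lambda>w. w $ j) ` zero_set J)"
    using uncountable_UNIV_complex uncountable_minus_countable by blast
next
  fix c assume c: "c \<in> UNIV - (\<lambda>w. w $ j) ` zero_set J"
  let ?K = "cring.span (insert (cpoly_var j - cpoly_const c) J)"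
  show "1 \<in> ?K"
  proof (rule ccontr)
    assume "1 \<notin> ?K"
    then obtain w where w: "w \<in> zero_set ?K"
      using weak_nullstellensatz[OF cring.subspace_span] by blast
    have "insert (cpoly_var j - cpoly_const c) J \<subseteq> ?K"
      by (rule cring.span_superset)
    with w have "w \<in> zero_set J" "cpoly_eval (cpoly_var j - cpoly_const c) w = 0"
      unfolding zero_set_def by blast+
    with c show False by auto
  qed
qed

subsection \<open>Density of ideals in the function space\<close>

lemma poly_on_add: "poly_on \<Omega> (P + Q) = poly_on \<Omega> P + poly_on \<Omega> Q"
  by (auto simp: poly_on_def)

lemma poly_on_mult: "poly_on \<Omega> (P * Q) = (\<lambda>z. cpoly_eval P z * poly_on \<Omega> Q z)"
  by (auto simp: poly_on_def)

lemma poly_on_0 [simp]: "poly_on \<Omega> 0 = 0"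
  by (auto simp: poly_on_def)

lemma cring_subspace_quotient_ideal: "cring.subspace (quotient_ideal g \<F>)"
  unfolding cring.subspace_def quotient_ideal_def ideal_gen_def
  by (auto simp: cring.span_zero cring.span_add distrib_left mult.left_commute intro: cring.span_scale)

locale poly_space =
  fixes \<Omega> :: "(complex ^ 'n::finite) set" and X :: "'n cfun topology"
  assumes tvs: "hausdorff_tvs_in_Hol \<Omega> X" and P1: "P1 \<Omega> X" and P3: "P3 X"
begin

lemma subspace_topspace: "cfun.subspace (topspace X)"
  using tvs by (simp add: hausdorff_tvs_in_Hol_def)

lemma continuous_map_add:
  assumes "continuous_map Z X f" "continuous_map Z X g"
  shows "continuous_map Z X (\<lambda>x. f x + g x)"
proof -
  have "continuous_map (prod_topology X X) X (\<lambda>(F, G). F + G)"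
    using tvs by (simp add: hausdorff_tvs_in_Hol_def)
  from continuous_map_compose[OF continuous_map_pairedI[OF assms] this] show ?thesis
    by (simp add: o_def)
qed

lemma continuous_map_scale:
  assumes "continuous_map Z euclidean c" "continuous_map Z X f"
  shows "continuous_map Z X (\<lambda>x z. c x * f x z)"
proof -
  have "continuous_map (prod_topology euclidean X) X (\<lambda>(c, F). (\<lambda>z. c * F z))"
    using tvs by (simp add: hausdorff_tvs_in_Hol_def)
  from continuous_map_compose[OF continuous_map_pairedI[OF assms] this] show ?thesis
    by (simp add: o_def)
qed

lemma continuous_map_mult: "continuous_map X X (\<lambda>F z. cpoly_eval P z * F z)"
proof (induction P rule: cpoly_induct)
  case (const c)
  show ?case
    using continuous_map_scale[of X "\<lambda>_. c" "\<lambda>F. F"] by simp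
next
  case (var j)
  show ?case using P3 by (simp add: P3_def)
next
  case (add P R)
  have "(\<lambda>F z. cpoly_eval (P + R) z * F z) = (\<lambda>F. (\<lambda>z. cpoly_eval P z * F z) + (\<lambda>z. cpoly_eval R z * F z))"
    by (simp add: fun_eq_iff distrib_right)
  then show ?case using continuous_map_add[OF add] by simp
next
  case (mult P R)
  from continuous_map_compose[OF mult(2,1)] show ?case
    by (simp add: o_def mult.assoc)
qed

lemma poly_on_in_topspace: "poly_on \<Omega> P \<in> topspace X"
  using P1 by (auto simp: P1_def)

text \<open>The closure of a product is the product of the closures, so joint continuity of addition
  applies to \<open>S \<times> S\<close>.\<close>

lemma add_in_closure:
  assumes "F \<in> X closure_of S" "G \<in> X closure_of S"
    and "\<And>F G. F \<in> S \<Longrightarrow> G \<in> S \<Longrightarrow> F + G \<in> S"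
  shows "F + G \<in> X closure_of S"
proof -
  have "continuous_map (prod_topology X X) X (\<lambda>(F, G). F + G)"
    using tvs by (simp add: hausdorff_tvs_in_Hol_def)
  from continuous_map_image_closure_subset[OF this, of "S \<times> S"] assms(1,2)
  have "F + G \<in> X closure_of ((\<lambda>(F, G). F + G) ` (S \<times> S))"
    by (auto simp: closure_of_Times)
  moreover have "(\<lambda>(F, G). F + G) ` (S \<times> S) \<subseteq> S"
    using assms(3) by auto
  ultimately show ?thesis
    using closure_of_mono by blast
qed

lemma mult_in_closure:
  assumes "F \<in> X closure_of S" "\<And>F. F \<in> S \<Longrightarrow> (\<lambda>z. cpoly_eval P z * F z) \<in> T"
  shows "(\<lambda>z. cpoly_eval P z * F z) \<in> X closure_of T"
proof -
  have "(\<lambda>z. cpoly_eval P z * F z) \<in> X closure_of ((\<lambda>F z. cpoly_eval P z * F z) ` S)"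
    using continuous_map_image_closure_subset[OF continuous_map_mult, of P S] assms(1) by auto
  moreover have "(\<lambda>F z. cpoly_eval P z * F z) ` S \<subseteq> T"
    using assms(2) by auto
  ultimately show ?thesis
    using closure_of_mono by blast
qed

text \<open>The closure in \<open>X\<close>, pulled back to polynomials, so that the algebraic
  arguments on ideals apply to density.\<close>

definition poly_closure :: "'n cpoly set \<Rightarrow> 'n cpoly set" where
  "poly_closure K = {P. poly_on \<Omega> P \<in> X closure_of (poly_on \<Omega> ` K)}"

lemma ideal_closure_poly_closure: "ideal_closure poly_closure"
proof
  show ext: "K \<subseteq> poly_closure K" for K
    using closure_of_subset[of "poly_on \<Omega> ` K" X] poly_on_in_topspace
    by (auto simp: poly_closure_def)
  show "poly_closure K \<subseteq> poly_closure K'" if "K \<subseteq> poly_closure K'" for K K'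
  proof -
    have "X closure_of (poly_on \<Omega> ` K) \<subseteq> X closure_of (poly_on \<Omega> ` K')"
      using that by (intro closure_of_minimal) (auto simp: poly_closure_def)
    then show ?thesis by (auto simp: poly_closure_def)
  qed
  show "a * p \<in> poly_closure ((*) a ` K)" if "p \<in> poly_closure K" for a p K
  proof -
    have "poly_on \<Omega> p \<in> X closure_of (poly_on \<Omega> ` K)"
      using that by (simp add: poly_closure_def)
    then have "(\<lambda>z. cpoly_eval a z * poly_on \<Omega> p z) \<in> X closure_of (poly_on \<Omega> ` (*) a ` K)"
      by (rule mult_in_closure) (auto simp flip: poly_on_mult)
    then show ?thesis by (simp add: poly_closure_def poly_on_mult)
  qed
  show "cring.subspace (poly_closure K)" if K: "cring.subspace K" for K
    unfolding cring.subspace_def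
  proof (intro conjI ballI allI)
    show "0 \<in> poly_closure K" using ext K cring.subspace_0 by blast
  next
    fix P Q assume "P \<in> poly_closure K" "Q \<in> poly_closure K"
    then have "poly_on \<Omega> P + poly_on \<Omega> Q \<in> X closure_of (poly_on \<Omega> ` K)"
      unfolding poly_closure_def mem_Collect_eq
      by (rule add_in_closure) (auto simp flip: poly_on_add intro: cring.subspace_add[OF K])
    then show "P + Q \<in> poly_closure K"
      by (simp add: poly_closure_def poly_on_add)
  next
    fix c P assume "P \<in> poly_closure K"
    then have "(\<lambda>z. cpoly_eval c z * poly_on \<Omega> P z) \<in> X closure_of (poly_on \<Omega> ` K)"
      unfolding poly_closure_def mem_Collect_eq
      by (rule mult_in_closure) (use cring.subspace_scale[OF K] in \<open>auto simp flip: poly_on_mult\<close>)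
    then show "c * P \<in> poly_closure K"
      by (simp add: poly_closure_def poly_on_mult)
  qed
qed

sublocale ideal_closure poly_closure
  by (rule ideal_closure_poly_closure)

text \<open>The closure is an ideal; once it contains \<open>1\<close> it contains all polynomials,
  which are dense by \<open>P1\<close>.\<close>

lemma dense_iff_one_in_poly_closure:
  assumes "cring.subspace K"
  shows "X closure_of (poly_on \<Omega> ` K) = topspace X \<longleftrightarrow> 1 \<in> poly_closure K"
proof
  assume "X closure_of (poly_on \<Omega> ` K) = topspace X"
  then show "1 \<in> poly_closure K"
    using poly_on_in_topspace by (simp add: poly_closure_def)
next
  assume 1: "1 \<in> poly_closure K"
  have "P \<in> poly_closure K" for P
    using cring.subspace_scale[OF ideal[OF assms] 1, of P] by simp
  then have "X closure_of (range (poly_on \<Omega>)) \<subseteq> X closure_of (poly_on \<Omega> ` K)"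
    by (intro closure_of_minimal) (auto simp: poly_closure_def)
  then show "X closure_of (poly_on \<Omega> ` K) = topspace X"
    using P1 by (simp add: P1_def closure_of_subset_topspace subset_antisym)
qed

lemma subspace_closure:
  assumes K: "cring.subspace K"
  shows "cfun.subspace (X closure_of (poly_on \<Omega> ` K))" (is "cfun.subspace ?N")
  unfolding cfun.subspace_def
proof (intro conjI ballI allI)
  have "0 \<in> poly_closure K"
    using ideal[OF K] by (rule cring.subspace_0)
  then show "0 \<in> ?N" by (simp add: poly_closure_def)
next
  fix F G assume "F \<in> ?N" "G \<in> ?N"
  then show "F + G \<in> ?N"
    by (rule add_in_closure) (auto simp flip: poly_on_add intro: cring.subspace_add[OF K])
next
  fix c F assume "F \<in> ?N"
  then have "(\<lambda>z. cpoly_eval (cpoly_const c) z * F z) \<in> ?N"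
    by (rule mult_in_closure)
      (auto simp flip: poly_on_mult simp del: cpoly_eval_const intro!: imageI cring.subspace_scale[OF K])
  then show "(\<lambda>z. c * F z) \<in> ?N" by simp
qed

lemma invariant_closure_poly_on:
  "invariant_closure X (poly_on \<Omega> Q) = X closure_of (poly_on \<Omega> ` range (\<lambda>P. P * Q))"
  by (simp add: invariant_closure_def image_image poly_on_mult)

lemma cyclic_iff: "cyclic X (poly_on \<Omega> g) \<longleftrightarrow> 1 \<in> poly_closure (cring.span {g})"
  unfolding cyclic_def invariant_closure_poly_on cring.span_singleton
  by (rule dense_iff_one_in_poly_closure)
    (metis cring.span_singleton cring.subspace_span)

text \<open>The closure of the ideal is a closed linear subspace containing each single invariant
  closure. Conversely, every element of the ideal is a sum of multiples of generators.\<close>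

lemma joint_invariant_closure_eq:
  "joint_invariant_closure X (poly_on \<Omega> ` \<F>) = X closure_of (poly_on \<Omega> ` ideal_gen \<F>)"
proof
  let ?N = "X closure_of (poly_on \<Omega> ` ideal_gen \<F>)"
  let ?S = "\<Union>F\<in>poly_on \<Omega> ` \<F>. invariant_closure X F"
  have "cfun.subspace ?N"
    by (simp add: subspace_closure ideal_gen_def)
  moreover have "?S \<subseteq> ?N"
  proof -
    have "invariant_closure X (poly_on \<Omega> Q) \<subseteq> ?N" if "Q \<in> \<F>" for Q
      unfolding invariant_closure_poly_on ideal_gen_def
      using that by (intro closure_of_mono image_mono) (auto intro: cring.span_scale cring.span_base)
    then show ?thesis by blast
  qed
  ultimately have "cfun.span ?S \<subseteq> ?N"
    by (rule cfun.span_minimal[rotated])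
  then show "joint_invariant_closure X (poly_on \<Omega> ` \<F>) \<subseteq> ?N"
    unfolding joint_invariant_closure_def by (rule closure_of_minimal) simp
  have "poly_on \<Omega> P \<in> cfun.span ?S" if "P \<in> cring.span \<F>" for P
    using that
  proof (induction rule: cring.span_induct_alt)
    case base
    show ?case using cfun.span_zero[of ?S] by (simp only: poly_on_0)
  next
    case (step c Q P)
    have "poly_on \<Omega> (c * Q) \<in> invariant_closure X (poly_on \<Omega> Q)"
      unfolding invariant_closure_poly_on
      using poly_on_in_topspace by (intro subsetD[OF closure_of_subset]) auto
    then have "poly_on \<Omega> (c * Q) \<in> cfun.span ?S"
      using step(1) by (intro cfun.span_base) auto
    from cfun.span_add[OF this step(2)] show ?case
      by (simp only: poly_on_add)
  qed
  then show "?N \<subseteq> joint_invariant_closure X (poly_on \<Omega> ` \<F>)"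
    unfolding joint_invariant_closure_def ideal_gen_def by (intro closure_of_mono) auto
qed

lemma jointly_cyclic_iff:
  "jointly_cyclic X (poly_on \<Omega> ` \<F>) \<longleftrightarrow> 1 \<in> poly_closure (ideal_gen \<F>)"
  unfolding jointly_cyclic_def joint_invariant_closure_eq
  by (rule dense_iff_one_in_poly_closure) (simp add: ideal_gen_def)

section \<open>Continuous functionals from closed subspaces of codimension one\<close>

text \<open>Hahn-Banach is not at hand without local convexity, so the functional is built directly.
  The coefficient of \<open>e\<close> is bounded near \<open>0\<close>; compactness of disks then
  shows that the dense space N + \<complex> e is everything, and the same bound gives
  continuity.\<close>

lemma ex_coefficient_functional:
  assumes N: "closedin X N" "cfun.subspace N" and e: "e \<in> topspace X" "e \<notin> N"
    and dense: "X closure_of {F \<in> topspace X. \<exists>c. F + (\<lambda>z. - c * e z) \<in> N} = topspace X"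
  shows "\<exists>\<phi>. continuous_linear_functional X \<phi> \<and> (\<forall>F c. F + (\<lambda>z. - c * e z) \<in> N \<longrightarrow> \<phi> F = c)"
proof -
  \<comment> \<open>\<open>?d c F\<close> is F - c e, and \<open>?D\<close> is N + \<complex>
    e.\<close>
  let ?d = "\<lambda>c F. F + (\<lambda>z. - c * e z)"
  let ?D = "{F \<in> topspace X. \<exists>c. ?d c F \<in> N}"
  have top_add: "F + G \<in> topspace X" if "F \<in> topspace X" "G \<in> topspace X" for F G
    using cfun.subspace_add[OF subspace_topspace that] .
  have top_scale: "(\<lambda>z. c * F z) \<in> topspace X" if "F \<in> topspace X" for c F
    using cfun.subspace_scale[OF subspace_topspace that] .
  have N_add: "F + G \<in> N" if "F \<in> N" "G \<in> N" for F G
    using cfun.subspace_add[OF N(2) that] .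
  have N_scale: "(\<lambda>z. c * F z) \<in> N" if "F \<in> N" for c F
    using cfun.subspace_scale[OF N(2) that] .
  have d_scale: "?d (a * c) (\<lambda>z. a * F z) \<in> N" if "?d c F \<in> N" for a c F
  proof -
    have "?d (a * c) (\<lambda>z. a * F z) = (\<lambda>z. a * ?d c F z)"
      by (simp add: fun_eq_iff algebra_simps)
    then show ?thesis using N_scale[OF that, of a] by (simp only:)
  qed
  have d_add: "?d (a + b) (F + G) \<in> N" if "?d a F \<in> N" "?d b G \<in> N" for a b F G
  proof -
    have "?d (a + b) (F + G) = ?d a F + ?d b G"
      by (simp add: fun_eq_iff algebra_simps)
    then show ?thesis using N_add[OF that] by (simp only:)
  qed
  have unique: "a = b" if "?d a F \<in> N" "?d b F \<in> N" for a b F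
  proof (rule ccontr)
    assume "a \<noteq> b"
    have "(\<lambda>z. inverse (b - a) * (?d a F + (\<lambda>z. (- 1) * ?d b F z)) z) \<in> N"
      by (rule N_scale[OF N_add[OF that(1) N_scale[OF that(2)]]])
    also have "(\<lambda>z. inverse (b - a) * (?d a F + (\<lambda>z. (- 1) * ?d b F z)) z)
        = (\<lambda>z. inverse (b - a) * ((b - a) * e z))"
      by (simp add: fun_eq_iff algebra_simps)
    also have "\<dots> = e"
      using \<open>a \<noteq> b\<close> by (simp add: fun_eq_iff mult.assoc[symmetric])
    finally show False using e(2) by simp
  qed
  have d_cont: "continuous_map Z X (\<lambda>x. ?d (c x) (f x))"
    if "continuous_map Z euclidean c" "continuous_map Z X f" for Z :: "'z topology" and c f
    using that e(1) by (intro continuous_map_add continuous_map_scale continuous_map_minus) auto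

  obtain \<delta> V where \<delta>: "\<delta> > 0" and V: "openin X V" "0 \<in> V"
    and bound: "\<And>F c. F \<in> V \<Longrightarrow> ?d c F \<in> N \<Longrightarrow> norm c \<le> 1 / \<delta>"
  proof -
    let ?Z = "prod_topology euclidean X :: (complex \<times> 'n cfun) topology"
    \<comment> \<open>\<open>?h (a, F)\<close> is e - a F, which stays outside the closed set
      \<open>N\<close> near (0, 0). A coefficient \<open>c\<close> with 1/c small would give e - F/c
      in \<open>N\<close>.\<close>
    let ?h = "\<lambda>x. e + (\<lambda>z. - fst x * snd x z)"
    have "continuous_map ?Z X ?h"
      using e(1) continuous_map_fst continuous_map_snd
      by (intro continuous_map_add continuous_map_scale continuous_map_minus) auto
    then have "openin ?Z {x \<in> topspace ?Z. ?h x \<in> topspace X - N}"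
      using N(1) by (intro openin_continuous_map_preimage) auto
    moreover have "(0, 0) \<in> {x \<in> topspace ?Z. ?h x \<in> topspace X - N}"
      using e cfun.subspace_0[OF subspace_topspace] by (auto simp: zero_fun_def plus_fun_def)
    ultimately have "\<exists>U V. openin euclidean U \<and> openin X V \<and> 0 \<in> U \<and> 0 \<in> V \<and>
        U \<times> V \<subseteq> {x \<in> topspace ?Z. ?h x \<in> topspace X - N}"
      unfolding openin_prod_topology_alt by simp
    then obtain U V where UV: "open U" "openin X V" "0 \<in> U" "0 \<in> V"
      and sub: "U \<times> V \<subseteq> {x \<in> topspace ?Z. ?h x \<in> topspace X - N}"
      by (auto simp del: mem_Collect_eq)
    obtain \<delta> where \<delta>: "\<delta> > 0" "ball 0 \<delta> \<subseteq> U"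
      using UV openE by blast
    have "norm c \<le> 1 / \<delta>" if "F \<in> V" "?d c F \<in> N" for F c
    proof (rule ccontr)
      assume "\<not> norm c \<le> 1 / \<delta>"
      then have c: "1 / \<delta> < norm c" by simp
      have "0 < norm c" using c \<delta>(1) by (metis less_trans zero_less_divide_1_iff)
      then have "norm (1 / c) < \<delta>"
        using c \<delta>(1) by (simp add: norm_divide field_simps)
      then have "1 / c \<in> U" using \<delta>(2) by (auto simp: dist_norm)
      then have "?h (1 / c, F) \<notin> N" using sub that(1) by blast
      moreover have "?h (1 / c, F) = (\<lambda>z. (- 1 / c) * ?d c F z)"
        using \<open>0 < norm c\<close> by (simp add: fun_eq_iff field_simps)
      ultimately show False using N_scale[OF that(2)] by metis
    qed
    then show ?thesis using that \<delta>(1) UV by blast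
  qed

  \<comment> \<open>The projection along a compact disk is a closed map; bounding the coefficient is
    what makes the set closed.\<close>
  have closed: "closedin X {F \<in> topspace X. \<exists>c\<in>cball 0 r. ?d c F \<in> N}" for r
  proof -
    let ?Z = "prod_topology (top_of_set (cball 0 r)) X :: (complex \<times> 'n cfun) topology"
    have "continuous_map ?Z euclidean fst"
      using continuous_map_fst continuous_map_into_fulltopology by blast
    then have "continuous_map ?Z X (\<lambda>x. ?d (fst x) (snd x))"
      using continuous_map_snd by (intro d_cont)
    then have "closedin ?Z {x \<in> topspace ?Z. ?d (fst x) (snd x) \<in> N}"
      using N(1) by (rule closedin_continuous_map_preimage)
    moreover have "compact_space (top_of_set (cball (0::complex) r))"
      by (simp add: compact_space_subtopology)
    ultimately have "closedin X (snd ` {x \<in> topspace ?Z. ?d (fst x) (snd x) \<in> N})"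
      using Abstract_Topological_Spaces.closed_map_snd unfolding closed_map_def by blast
    also have "snd ` {x \<in> topspace ?Z. ?d (fst x) (snd x) \<in> N}
        = {F \<in> topspace X. \<exists>c\<in>cball 0 r. ?d c F \<in> N}"
      by force
    finally show ?thesis .
  qed

  \<comment> \<open>For small nonzero \<open>t\<close>, the vector t F lies in \<open>V\<close>.
    Elements of \<open>?D\<close> near \<open>F\<close> then have coefficients bounded by
    1/(\<delta> |t|), so \<open>closed\<close> passes the decomposition on to their limit
    \<open>F\<close>.\<close>
  have exists: "\<exists>c. ?d c F \<in> N" if F: "F \<in> topspace X" for F
  proof -
    have "continuous_map euclidean X (\<lambda>c z. c * F z)"
      using F by (intro continuous_map_scale) auto
    then have "open {c. (\<lambda>z. c * F z) \<in> V}"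
      using openin_continuous_map_preimage[OF _ V(1)] by fastforce
    moreover have "0 \<in> {c. (\<lambda>z. c * F z) \<in> V}"
      using V(2) by (simp add: zero_fun_def)
    ultimately obtain \<epsilon> where \<epsilon>: "\<epsilon> > 0" "ball 0 \<epsilon> \<subseteq> {c. (\<lambda>z. c * F z) \<in> V}"
      using openE by blast
    define t where "t = complex_of_real (\<epsilon> / 2)"
    have "t \<in> ball 0 \<epsilon>" using \<epsilon>(1) by (simp add: t_def dist_norm norm_mult)
    then have t: "(\<lambda>z. t * F z) \<in> V" using \<epsilon>(2) by blast
    have "t \<noteq> 0" using \<epsilon>(1) by (simp add: t_def)
    let ?V = "{G \<in> topspace X. (\<lambda>z. t * G z) \<in> V}"
    have "continuous_map X X (\<lambda>G z. t * G z)"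
      by (intro continuous_map_scale) auto
    then have "openin X ?V"
      using V(1) by (rule openin_continuous_map_preimage)
    have "F \<in> X closure_of (?V \<inter> ?D)"
      using openin_Int_closure_of_subset[OF \<open>openin X ?V\<close>, of ?D] F t dense by auto
    moreover have "?V \<inter> ?D \<subseteq> {F \<in> topspace X. \<exists>c\<in>cball 0 (1 / \<delta> / norm t). ?d c F \<in> N}"
    proof clarsimp
      fix G c assume G: "(\<lambda>z. t * G z) \<in> V" "(G + (\<lambda>z. - (c * e z))) \<in> N"
      have "norm (t * c) \<le> 1 / \<delta>"
        using d_scale[of G c t] G by (intro bound[of "\<lambda>z. t * G z"]) auto
      then have "norm c \<le> 1 / (\<delta> * norm t)"
        using \<open>t \<noteq> 0\<close> \<delta> by (simp add: norm_mult field_simps)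
      then show "\<exists>c\<in>cball 0 (1 / (\<delta> * norm t)). (G + (\<lambda>z. - (c * e z))) \<in> N"
        using G(2) by auto
    qed
    ultimately show ?thesis
      using closure_of_minimal[OF _ closed] by blast
  qed

  define \<phi> where "\<phi> F = (THE c. ?d c F \<in> N)" for F
  have \<phi>_eq: "\<phi> F = c" if "?d c F \<in> N" for F c
    unfolding \<phi>_def using that unique by (intro the_equality)
  have \<phi>: "?d (\<phi> F) F \<in> N" if "F \<in> topspace X" for F
    using exists[OF that] \<phi>_eq by auto
  have \<phi>_add: "\<phi> (F + G) = \<phi> F + \<phi> G" if "F \<in> topspace X" "G \<in> topspace X" for F G
    using d_add[OF \<phi> \<phi>] that \<phi>_eq by blast
  have \<phi>_scale: "\<phi> (\<lambda>z. c * F z) = c * \<phi> F" if "F \<in> topspace X" for c F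
    using d_scale[OF \<phi>] that \<phi>_eq by blast
  have "continuous_map X euclidean \<phi>"
    unfolding continuous_map_def
  proof (intro conjI allI impI)
    fix T :: "complex set" assume T: "openin euclidean T"
    show "openin X {F \<in> topspace X. \<phi> F \<in> T}"
    proof (subst openin_subopen, intro ballI)
      fix F assume "F \<in> {F \<in> topspace X. \<phi> F \<in> T}"
      then have F: "F \<in> topspace X" "\<phi> F \<in> T" by auto
      with T obtain \<epsilon> where \<epsilon>: "\<epsilon> > 0" "ball (\<phi> F) \<epsilon> \<subseteq> T"
        by (auto elim: openE)
      \<comment> \<open>With this scale, s (G - F) in \<open>V\<close> bounds the difference of the
        coefficients by \<epsilon>/2.\<close>
      define s where "s = complex_of_real (2 / (\<delta> * \<epsilon>))"
      have norm_s: "norm s = 2 / (\<delta> * \<epsilon>)"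
        using \<epsilon>(1) \<delta> by (simp only: s_def norm_of_real) simp
      let ?k = "\<lambda>G z. s * (G + (\<lambda>z. (- 1) * F z)) z"
      have "continuous_map X X ?k"
        using F(1) top_scale[of F "- 1"] by (intro continuous_map_scale continuous_map_add) auto
      then have "openin X {G \<in> topspace X. ?k G \<in> V}"
        using V(1) by (rule openin_continuous_map_preimage)
      moreover have "?k F = 0" by (simp add: fun_eq_iff)
      then have "F \<in> {G \<in> topspace X. ?k G \<in> V}"
        using F V(2) by simp
      moreover have "\<phi> G \<in> T" if G: "G \<in> topspace X" "?k G \<in> V" for G
      proof -
        have "\<phi> (?k G) = s * (\<phi> G + (- 1) * \<phi> F)"
          using G F top_scale[of F "- 1"] by (simp only: \<phi>_scale \<phi>_add top_add)
        then have "norm (s * (\<phi> G - \<phi> F)) \<le> 1 / \<delta>"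
          using bound[OF G(2) \<phi>] top_scale[OF top_add[OF G(1) top_scale[OF F(1), of "- 1"]], of s]
          by simp
        then have "2 / (\<delta> * \<epsilon>) * norm (\<phi> G - \<phi> F) \<le> 1 / \<delta>"
          by (simp only: norm_mult norm_s)
        then have "norm (\<phi> G - \<phi> F) \<le> \<epsilon> / 2"
          using \<epsilon>(1) \<delta> by (simp add: field_simps)
        then have "norm (\<phi> G - \<phi> F) < \<epsilon>" using \<epsilon>(1) by simp
        then show ?thesis
          using \<epsilon>(2) by (auto simp: dist_norm norm_minus_commute)
      qed
      ultimately show "\<exists>S. openin X S \<and> F \<in> S \<and> S \<subseteq> {F \<in> topspace X. \<phi> F \<in> T}"
        by (intro exI[of _ "{G \<in> topspace X. ?k G \<in> V}"]) auto
    qed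
  qed auto
  then show ?thesis
    using \<phi>_add \<phi>_scale \<phi>_eq unfolding continuous_linear_functional_def by blast
qed

text \<open>P - P(w) lies in the maximal ideal of \<open>w\<close>, so modulo the closure of that
  ideal the coefficient of \<open>1\<close> in \<open>P\<close> is P(w).\<close>

lemma in_max_domain:
  assumes "1 \<notin> poly_closure {P. cpoly_eval P w = 0}"
  shows "w \<in> max_domain \<Omega> X"
proof -
  let ?m = "{P. cpoly_eval P w = 0}"
  let ?N = "X closure_of (poly_on \<Omega> ` ?m)" and ?e = "poly_on \<Omega> 1"
  have m: "cring.subspace ?m" by (simp add: cring.subspace_def)
  have base: "poly_on \<Omega> P \<in> ?N" if "P \<in> ?m" for P
    using that extensive[of ?m] unfolding poly_closure_def by blast
  have "cfun.subspace ?N"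
    using m by (rule subspace_closure)
  moreover have poly: "poly_on \<Omega> P + (\<lambda>z. - cpoly_eval P w * ?e z) \<in> ?N" for P
  proof -
    have "poly_on \<Omega> P + (\<lambda>z. - cpoly_eval P w * ?e z) = poly_on \<Omega> (P - cpoly_const (cpoly_eval P w))"
      by (auto simp: poly_on_def)
    then show ?thesis using base[of "P - cpoly_const (cpoly_eval P w)"] by simp
  qed
  have "X closure_of {F \<in> topspace X. \<exists>c. F + (\<lambda>z. - c * ?e z) \<in> ?N} = topspace X" (is "X closure_of ?D = _")
  proof -
    have "range (poly_on \<Omega>) \<subseteq> ?D"
      using poly poly_on_in_topspace by blast
    from closure_of_mono[OF this, of X] show ?thesis
      using P1 closure_of_subset_topspace[of X ?D] by (simp add: P1_def)
  qed
  ultimately obtain \<phi> where "continuous_linear_functional X \<phi>"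
      "\<And>F c. F + (\<lambda>z. - c * ?e z) \<in> ?N \<Longrightarrow> \<phi> F = c"
    using ex_coefficient_functional[of ?N ?e] assms poly_on_in_topspace[of 1]
    by (auto simp: poly_closure_def)
  then show ?thesis
    using poly unfolding max_domain_def by blast
qed

text \<open>A continuous extension of evaluation at a common zero vanishes on the ideal and hence on
  its closure, yet takes the value 1 at \<open>1\<close>.\<close>

lemma zero_set_disjoint_max_domain:
  assumes "1 \<in> poly_closure (ideal_gen \<F>)"
  shows "zero_set \<F> \<inter> max_domain \<Omega> X = {}"
proof (rule ccontr)
  assume "\<not> ?thesis"
  then obtain w \<phi> where w: "w \<in> zero_set \<F>" and \<phi>: "continuous_map X euclidean \<phi>"
      "\<And>P. \<phi> (poly_on \<Omega> P) = cpoly_eval P w"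
    by (auto simp: max_domain_def continuous_linear_functional_def)
  have "cpoly_eval P w = 0" if "P \<in> cring.span \<F>" for P
    using that
    by (induction rule: cring.span_induct_alt) (use w in \<open>auto simp: zero_set_def\<close>)
  then have "poly_on \<Omega> ` ideal_gen \<F> \<subseteq> {F \<in> topspace X. \<phi> F \<in> {0}}"
    using poly_on_in_topspace \<phi>(2) by (auto simp: ideal_gen_def)
  then have "X closure_of (poly_on \<Omega> ` ideal_gen \<F>) \<subseteq> {F \<in> topspace X. \<phi> F \<in> {0}}"
    by (rule closure_of_minimal) (rule closedin_continuous_map_preimage[OF \<phi>(1)], simp)
  then have "\<phi> (poly_on \<Omega> 1) = 0"
    using assms by (auto simp: poly_closure_def)
  then show False using \<phi>(2)[of 1] by simp
qed

text \<open>The products of linear factors found in \<open>J\<close> lie in every larger ideal, so a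
  suitable factor can be adjoined for each variable. The point reached is a zero of \<open>J\<close>
  in the maximal domain.\<close>

lemma dense_of_finite_zero_set:
  assumes J: "cring.subspace J" and "finite (zero_set J)" "zero_set J \<inter> max_domain \<Omega> X = {}"
  shows "1 \<in> poly_closure J"
proof (rule ccontr)
  assume "1 \<notin> poly_closure J"
  have "\<exists>w\<in>zero_set J. 1 \<notin> poly_closure {P. cpoly_eval P w = 0}"
  proof (rule ex_zero_not_dense[OF ideal_closure_poly_closure J \<open>1 \<notin> poly_closure J\<close>])
    fix K :: "'n cpoly set" and j
    assume K: "cring.subspace K" "J \<subseteq> K" "1 \<notin> poly_closure K"
    obtain cs where "(\<Prod>c\<leftarrow>cs. cpoly_var j - cpoly_const c) \<in> K"
      using ex_prod_linear_in_ideal_of_finite_zero_set[OF assms(1,2)] K(2) by blast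
    then have "\<exists>a\<in>set (map (\<lambda>c. cpoly_var j - cpoly_const c) cs). 1 \<notin> poly_closure (cring.span (insert a K))"
      by (rule ex_factor_not_dense[OF K(1,3)])
    then show "\<exists>c. 1 \<notin> poly_closure (cring.span (insert (cpoly_var j - cpoly_const c) K))"
      by auto
  qed
  then show False using in_max_domain assms(3) by blast
qed

end

theorem theorem3p7:
  fixes \<Omega> :: "(complex ^ 'n::finite) set"
    and X :: "'n cfun topology"
    and \<F> :: "'n cpoly set"
    and g :: "'n cpoly"
  assumes "open \<Omega>" and "\<Omega> \<noteq> {}"
    and "hausdorff_tvs_in_Hol \<Omega> X"
    and "P1 \<Omega> X" and "P2 \<Omega> X" and "P3 X"
    and "is_gcd_of g \<F>"
    and "finite (zero_set (quotient_ideal g \<F>))"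
  shows "jointly_cyclic X (poly_on \<Omega> ` \<F>) \<longleftrightarrow>
           zero_set \<F> \<inter> max_domain \<Omega> X = {} \<and> cyclic X (poly_on \<Omega> g)"
proof -
  interpret poly_space \<Omega> X by unfold_locales (use assms in auto)
  let ?J = "quotient_ideal g \<F>"
  have dvd: "g dvd P" if "P \<in> \<F>" for P
    using that assms(7) by (simp add: is_gcd_of_def)
  have J: "cring.subspace ?J" by (rule cring_subspace_quotient_ideal)
  show ?thesis
    unfolding jointly_cyclic_iff cyclic_iff
  proof (intro iffI conjI)
    assume dense: "1 \<in> poly_closure (ideal_gen \<F>)"
    then show "zero_set \<F> \<inter> max_domain \<Omega> X = {}"
      by (rule zero_set_disjoint_max_domain)
    have "\<F> \<subseteq> cring.span {g}"
      using dvd by (auto simp: cring.span_singleton dvd_def mult.commute)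
    then have "ideal_gen \<F> \<subseteq> cring.span {g}"
      unfolding ideal_gen_def by (rule cring.span_minimal) simp
    then show "1 \<in> poly_closure (cring.span {g})"
      using mono dense by blast
  next
    assume *: "zero_set \<F> \<inter> max_domain \<Omega> X = {} \<and> 1 \<in> poly_closure (cring.span {g})"
    \<comment> \<open>Each member of the family is \<open>g * Q\<close> with \<open>Q\<close> in the
      quotient ideal.\<close>
    have "zero_set ?J \<subseteq> zero_set \<F>"
    proof
      fix w assume w: "w \<in> zero_set ?J"
      have "cpoly_eval P w = 0" if P: "P \<in> \<F>" for P
      proof -
        obtain Q where Q: "P = g * Q" using dvd[OF P] by (elim dvdE)
        then have "Q \<in> ?J"
          using P by (auto simp: quotient_ideal_def ideal_gen_def intro: cring.span_base)
        then show ?thesis using w Q by (simp add: zero_set_def)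
      qed
      then show "w \<in> zero_set \<F>" by (simp add: zero_set_def)
    qed
    with * have "1 \<in> poly_closure ?J"
      using assms(8) by (intro dense_of_finite_zero_set J) auto
    \<comment> \<open>Multiplication by \<open>g\<close> carries density of the quotient ideal to
      membership of \<open>g\<close> in the closure of the generated ideal, which therefore contains
      the closure of (g).\<close>
    then have "g * 1 \<in> poly_closure ((*) g ` ?J)"
      by (rule mult)
    moreover have "(*) g ` ?J \<subseteq> ideal_gen \<F>"
      by (auto simp: quotient_ideal_def)
    ultimately have "g \<in> poly_closure (ideal_gen \<F>)"
      using mono[of "(*) g ` ?J" "ideal_gen \<F>"] by auto
    then have "cring.span {g} \<subseteq> poly_closure (ideal_gen \<F>)"
      by (intro cring.span_minimal ideal) (auto simp: ideal_gen_def)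
    then show "1 \<in> poly_closure (ideal_gen \<F>)"
      using least * by blast
  qed
qed

end
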